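(* Let $\alpha$ be a dotted composition. Then, in $\mathbf{sNSym}$, $$R_{\alpha}=\sum_{\alpha\preceq\beta}(-1)^{\ell(\alpha)-\ell(\beta)}H_{\beta}.$$
   Context: Let $\mathbb N=\{1,2,\ldots\}$ and $\dot{\mathbb N}_0=\{\dot0,\dot1,\dot2,\ldots\}$ (dotted copies of the nonnegative integers). A dotted composition is a finite tuple $\alpha=(\alpha_1,\ldots,\alpha_k)$ with entries in $\mathbb N\cup\dot{\mathbb N}_0$; its length is $\ell(\alpha)=k$. For entries not both dotted put $m\oplus n=m+n$ and $m\oplus\dot n=\dot m\oplus n=\dot r$ with $r=m+n$. The partial order $\preceq$ on dotted compositions is the reflexive-transitive closure of the relation: $\beta$ is obtained from $\alpha$ by replacing two consecutive entries $x,y$ of $\alpha$ that are not both dotted by the single entry $x\oplus y$ (then $\alpha\preceq\beta$). $\mathbf{sNSym}$, as an algebra, is the free associative unital $\mathbb Q$-algebra on generators $H_n$ ($n\in\mathbb N$) and $H_{\dot n}=\tilde H_n$ ($n\ge0$); $H_\alpha:=H_{\alpha_1}\cdots H_{\alpha_k}$. The noncommutative Ribbon Schur functions in superspace $R_\alpha\in\mathbf{sNSym}$ are defined recursively by $R_\alpha=H_\alpha-\sum_{\alpha\prec\beta}R_\beta$. *)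

theory Defs
  imports Complex_Main "HOL-Library.Poly_Mapping"
begin

text \<open>The type \<^typ>\<open>num\<close> is HOL's type of the integers 1, 2, 3, ..., so that \<open>entry\<close> is the
  disjoint union of the positive integers and the dotted nonnegative integers.\<close>

datatype entry = Undotted num | Dotted nat

definition is_dotted :: "entry \<Rightarrow> bool" where
  "is_dotted x \<longleftrightarrow> (\<exists>n. x = Dotted n)"

text \<open>Left unspecified for two dotted entries.\<close>

fun oplus :: "entry \<Rightarrow> entry \<Rightarrow> entry"  (infixl "\<oplus>" 65) where
  "Undotted m \<oplus> Undotted n = Undotted (m + n)"
| "Undotted m \<oplus> Dotted n = Dotted (nat_of_num m + n)"
| "Dotted m \<oplus> Undotted n = Dotted (m + nat_of_num n)"

text \<open>Dotted compositions are words in \<open>entry\<close>. They are wrapped in a type of their own so that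
  they form a monoid under concatenation, written additively because the product of
  \<^theory>\<open>HOL-Library.Poly_Mapping\<close> is convolution over an additive monoid (which need not be
  commutative).\<close>

datatype dcomp = DComp (entries: "entry list")

definition len :: "dcomp \<Rightarrow> nat"  ("\<ell>") where
  "\<ell> \<alpha> = length (entries \<alpha>)"

instantiation dcomp :: monoid_add
begin

definition zero_dcomp :: dcomp where
  "0 = DComp []"

definition plus_dcomp :: "dcomp \<Rightarrow> dcomp \<Rightarrow> dcomp" where
  "\<alpha> + \<beta> = DComp (entries \<alpha> @ entries \<beta>)"

instance
  by standard (simp_all add: zero_dcomp_def plus_dcomp_def)

end

inductive merge :: "dcomp \<Rightarrow> dcomp \<Rightarrow> bool" where
  "\<not> (is_dotted x \<and> is_dotted y) \<Longrightarrow>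
     merge (DComp (us @ [x, y] @ vs)) (DComp (us @ [x \<oplus> y] @ vs))"

definition dcomp_le :: "dcomp \<Rightarrow> dcomp \<Rightarrow> bool"  (infix "\<preceq>" 50) where
  "\<alpha> \<preceq> \<beta> \<longleftrightarrow> merge\<^sup>*\<^sup>* \<alpha> \<beta>"

definition dcomp_less :: "dcomp \<Rightarrow> dcomp \<Rightarrow> bool"  (infix "\<prec>" 50) where
  "\<alpha> \<prec> \<beta> \<longleftrightarrow> \<alpha> \<preceq> \<beta> \<and> \<alpha> \<noteq> \<beta>"

lemma merge_len: "merge \<alpha> \<beta> \<Longrightarrow> \<ell> \<alpha> = Suc (\<ell> \<beta>)"
  by (auto simp: len_def elim: merge.cases)

lemma dcomp_le_len: "\<alpha> \<preceq> \<beta> \<Longrightarrow> \<ell> \<beta> \<le> \<ell> \<alpha>"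
  unfolding dcomp_le_def by (induction rule: rtranclp_induct) (auto dest: merge_len)

lemma dcomp_less_len: "\<alpha> \<prec> \<beta> \<Longrightarrow> \<ell> \<beta> < \<ell> \<alpha>"
proof -
  assume "\<alpha> \<prec> \<beta>"
  then obtain \<gamma> where "merge \<alpha> \<gamma>" "\<gamma> \<preceq> \<beta>"
    unfolding dcomp_less_def dcomp_le_def by (metis converse_rtranclpE)
  then show ?thesis
    using merge_len dcomp_le_len by fastforce
qed

lemma finite_merge: "finite {\<beta>. merge \<alpha> \<beta>}"
proof -
  let ?f = "\<lambda>i. DComp (take i (entries \<alpha>) @ [entries \<alpha> ! i \<oplus> entries \<alpha> ! Suc i] @
                drop (Suc (Suc i)) (entries \<alpha>))"
  have "{\<beta>. merge \<alpha> \<beta>} \<subseteq> ?f ` {..<\<ell> \<alpha>}"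
  proof
    fix \<beta> assume "\<beta> \<in> {\<beta>. merge \<alpha> \<beta>}"
    then obtain us x y vs where *: "\<alpha> = DComp (us @ [x, y] @ vs)"
      "\<beta> = DComp (us @ [x \<oplus> y] @ vs)"
      by (blast elim: merge.cases)
    have "\<beta> = ?f (length us)"
      by (simp add: * nth_append)
    moreover have "length us < \<ell> \<alpha>"
      by (simp add: * len_def)
    ultimately show "\<beta> \<in> ?f ` {..<\<ell> \<alpha>}" by blast
  qed
  then show ?thesis
    by (rule finite_subset) simp
qed

text \<open>All sums over coarsenings below are finite sums.\<close>

lemma finite_dcomp_ge: "finite {\<beta>. \<alpha> \<preceq> \<beta>}"
proof (induction "\<ell> \<alpha>" arbitrary: \<alpha> rule: less_induct)
  case less
  have "{\<beta>. \<alpha> \<preceq> \<beta>} \<subseteq> insert \<alpha> (\<Union>\<gamma>\<in>{\<gamma>. merge \<alpha> \<gamma>}. {\<beta>. \<gamma> \<preceq> \<beta>})"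
    unfolding dcomp_le_def by (auto elim: converse_rtranclpE)
  moreover have "finite \<dots>"
    using less finite_merge merge_len by force
  ultimately show ?case
    by (rule finite_subset)
qed

lemma finite_dcomp_greater: "finite {\<beta>. \<alpha> \<prec> \<beta>}"
  by (rule finite_subset[OF _ finite_dcomp_ge[of \<alpha>]]) (auto simp: dcomp_less_def)

text \<open>The free associative unital algebra over the rationals on the set of all entries, realised as
  the monoid algebra of the free monoid of words: finitely supported functions from words to
  rationals, with convolution along concatenation as product.\<close>

type_synonym sNSym = "dcomp \<Rightarrow>\<^sub>0 rat"

definition H_gen :: "entry \<Rightarrow> sNSym" where
  "H_gen x = Poly_Mapping.single (DComp [x]) 1"

definition H :: "dcomp \<Rightarrow> sNSym" where
  "H \<alpha> = prod_list (map H_gen (entries \<alpha>))"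

lemma H_eq_single: "H \<alpha> = Poly_Mapping.single \<alpha> 1"
proof -
  have "prod_list (map H_gen xs) = Poly_Mapping.single (DComp xs) 1" for xs
    by (induction xs)
      (simp_all add: H_gen_def mult_single plus_dcomp_def flip: zero_dcomp_def single_one)
  from this[of "entries \<alpha>"] show ?thesis
    by (simp add: H_def)
qed

function R :: "dcomp \<Rightarrow> sNSym" where
  "R \<alpha> = H \<alpha> - (\<Sum>\<beta> | \<alpha> \<prec> \<beta>. R \<beta>)"
  by auto
termination
  by (relation "measure \<ell>") (auto dest: dcomp_less_len)

declare R.simps [simp del]

end

theory Submission imports Defs begin

text \<open>
  The claim is Moebius inversion on the poset of dotted compositions: the recursion for \<^const>\<open>R\<close>
  says that \<open>H \<alpha>\<close> is the sum of \<open>R \<beta>\<close> over all \<open>\<beta> \<succeq> \<alpha>\<close>, and the theorem says that the Moebius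
  function is \<open>(-1) ^ (\<ell> \<alpha> - \<ell> \<beta>)\<close>. By induction along \<open>\<prec>\<close> this reduces to one fact
  (\<open>interval_sign_sum\<close>): for \<open>\<alpha> \<prec> \<beta>\<close> the signs \<open>(-1) ^ \<ell> \<gamma>\<close> cancel over the interval
  \<open>\<alpha> \<preceq> \<gamma> \<preceq> \<beta>\<close>.

  The cancellation rests on two properties of a merge: \<open>x \<oplus> y\<close> never equals \<open>x\<close>, and it determines
  \<open>y\<close> once \<open>x\<close> is known. Coarsenings are read from the left, where the first entry \<open>x\<close> of \<open>\<alpha>\<close> is
  either kept or absorbed into the first entry of a coarsening of the rest. If \<open>\<beta>\<close> keeps \<open>x\<close>, so does
  everything in the interval, and \<open>x\<close> can be dropped, which leaves a shorter case of the same claim.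
  If \<open>\<beta>\<close> absorbs \<open>x\<close>, then \<open>x # y # ys \<mapsto> (x \<oplus> y) # ys\<close> matches the \<open>\<gamma>\<close> that keep \<open>x\<close> with those that
  absorb it; lengths in a pair differ by one, so the signs cancel in pairs
  (\<open>coarsens_interval_sign_sum\<close>).
\<close>

section \<open>Merging two entries\<close>

abbreviation mergeable :: "entry \<Rightarrow> entry \<Rightarrow> bool" where
  "mergeable x y \<equiv> \<not> (is_dotted x \<and> is_dotted y)"

lemma nat_of_num_neq_0 [simp]: "nat_of_num m \<noteq> 0"
  using nat_of_num_pos[of m] by simp

lemma num_add_neq_left: "(m :: num) + n \<noteq> m"
  by (simp add: num_eq_iff nat_of_num_add)

text \<open>Even the entry dotted \<open>0\<close> is not neutral: it contributes its dot.\<close>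

lemma oplus_neq_left: "mergeable x y \<Longrightarrow> x \<oplus> y \<noteq> x"
  by (cases x; cases y) (auto simp: is_dotted_def num_add_neq_left)

lemma oplus_left_cancel:
  "mergeable x y \<Longrightarrow> mergeable x z \<Longrightarrow> x \<oplus> y = x \<oplus> z \<Longrightarrow> y = z"
  by (cases x; cases y; cases z)
    (auto simp: is_dotted_def num_eq_iff nat_of_num_add)

lemma mergeable_assoc:
  "mergeable x y \<and> mergeable (x \<oplus> y) z \<longleftrightarrow> mergeable y z \<and> mergeable x (y \<oplus> z)"
  by (cases x; cases y; cases z) (auto simp: is_dotted_def)

lemma oplus_assoc:
  "mergeable x y \<Longrightarrow> mergeable (x \<oplus> y) z \<Longrightarrow> x \<oplus> y \<oplus> z = x \<oplus> (y \<oplus> z)"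
  by (cases x; cases y; cases z)
    (auto simp: is_dotted_def num_eq_iff nat_of_num_add)

section \<open>Coarsening read from the left\<close>

text \<open>The order on dotted compositions, presented so that the first entry can be peeled off:
  it is either kept or absorbed by the first entry of a coarsening of the tail.\<close>

inductive coarsens :: "entry list \<Rightarrow> entry list \<Rightarrow> bool" where
  Nil: "coarsens [] []"
| keep: "coarsens xs ys \<Longrightarrow> coarsens (x # xs) (x # ys)"
| absorb: "coarsens xs (y # ys) \<Longrightarrow> mergeable x y \<Longrightarrow> coarsens (x # xs) ((x \<oplus> y) # ys)"

lemma coarsens_ConsE [consumes 1, case_names keep absorb]:
  assumes "coarsens (x # xs) zs"
  obtains ys where "zs = x # ys" "coarsens xs ys"
  | y ys where "zs = (x \<oplus> y) # ys" "coarsens xs (y # ys)" "mergeable x y"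
  using assms by (cases rule: coarsens.cases) auto

lemma coarsens_refl: "coarsens xs xs"
  by (induction xs) (auto intro: coarsens.intros)

text \<open>\<^const>\<open>coarsens\<close> builds up each merged block from the right. A block that starts from an already
  merged \<open>x \<oplus> y\<close> is brought to that form by associativity.\<close>

lemma coarsens_split_head:
  assumes "mergeable x y" "coarsens ((x \<oplus> y) # vs) zs"
  shows "coarsens (x # y # vs) zs"
  using assms(2)
proof (cases rule: coarsens_ConsE)
  case (keep ys)
  then show ?thesis using assms(1) by (auto intro: coarsens.intros)
next
  case (absorb z ys)
  have *: "mergeable y z" "mergeable x (y \<oplus> z)"
    using mergeable_assoc[of x y z] assms(1) absorb by auto
  have "coarsens (y # vs) ((y \<oplus> z) # ys)"
    using absorb * by (blast intro: coarsens.absorb)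
  then have "coarsens (x # y # vs) ((x \<oplus> (y \<oplus> z)) # ys)"
    using * by (blast intro: coarsens.absorb)
  then show ?thesis
    using absorb assms(1) by (simp add: oplus_assoc)
qed

lemma coarsens_split:
  assumes "mergeable x y" "coarsens (us @ (x \<oplus> y) # vs) zs"
  shows "coarsens (us @ x # y # vs) zs"
  using assms(2)
proof (induction us arbitrary: zs)
  case Nil
  then show ?case using coarsens_split_head[OF assms(1)] by simp
next
  case (Cons u us)
  from Cons.prems show ?case
    by (auto elim!: coarsens_ConsE intro!: coarsens.intros Cons.IH)
qed

lemma merge_Cons: "merge (DComp xs) (DComp ys) \<Longrightarrow> merge (DComp (x # xs)) (DComp (x # ys))"
  by (auto elim!: merge.cases) (use merge.intros[of _ _ "x # _"] in auto)+

lemma dcomp_le_Cons: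
  assumes "DComp xs \<preceq> DComp ys"
  shows "DComp (x # xs) \<preceq> DComp (x # ys)"
proof -
  have "merge\<^sup>*\<^sup>* (DComp (x # entries \<alpha>)) (DComp (x # entries \<beta>))" if "merge\<^sup>*\<^sup>* \<alpha> \<beta>" for \<alpha> \<beta>
    using that
  proof (induction rule: rtranclp_induct)
    case (step \<beta> \<gamma>)
    then show ?case
      by (metis dcomp.exhaust_sel merge_Cons rtranclp.rtrancl_into_rtrancl)
  qed simp
  from this[OF assms[unfolded dcomp_le_def]] show ?thesis
    by (simp add: dcomp_le_def)
qed

lemma dcomp_le_iff_coarsens: "\<alpha> \<preceq> \<beta> \<longleftrightarrow> coarsens (entries \<alpha>) (entries \<beta>)"
proof
  assume "\<alpha> \<preceq> \<beta>"
  then show "coarsens (entries \<alpha>) (entries \<beta>)"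
    unfolding dcomp_le_def
  proof (induction rule: converse_rtranclp_induct)
    case base
    show ?case by (rule coarsens_refl)
  next
    case (step \<alpha> \<gamma>)
    then show ?case by (auto elim!: merge.cases intro: coarsens_split)
  qed
next
  have "DComp xs \<preceq> DComp ys" if "coarsens xs ys" for xs ys
    using that
  proof (induction rule: coarsens.induct)
    case Nil
    show ?case by (simp add: dcomp_le_def)
  next
    case (keep xs ys x)
    then show ?case by (simp add: dcomp_le_Cons)
  next
    case (absorb xs y ys x)
    have "merge (DComp (x # y # ys)) (DComp ((x \<oplus> y) # ys))"
      using merge.intros[of x y "[]" ys] absorb.hyps by simp
    moreover have "DComp (x # xs) \<preceq> DComp (x # y # ys)"
      using absorb.IH by (rule dcomp_le_Cons)
    ultimately show ?case
      by (simp add: dcomp_le_def)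
  qed
  from this[of "entries \<alpha>" "entries \<beta>"]
  show "coarsens (entries \<alpha>) (entries \<beta>) \<Longrightarrow> \<alpha> \<preceq> \<beta>" by simp
qed

lemma finite_coarsens: "finite {ys. coarsens xs ys}"
proof -
  have "{ys. coarsens xs ys} = entries ` {\<beta>. DComp xs \<preceq> \<beta>}"
    by (force simp: dcomp_le_iff_coarsens image_iff intro: exI[of _ "DComp _"])
  then show ?thesis by (simp add: finite_dcomp_ge)
qed

text \<open>By associativity, whatever \<open>x \<oplus> y\<close> absorbs next, the result is still \<open>x\<close> merged with something.
  This is why all of an interval keeps \<open>x\<close> as soon as its upper end does.\<close>

lemma not_coarsens_oplus_Cons:
  assumes "mergeable x y"
  shows "\<not> coarsens ((x \<oplus> y) # ys) (x # zs)"
proof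
  assume "coarsens ((x \<oplus> y) # ys) (x # zs)"
  then show False
  proof (cases rule: coarsens_ConsE)
    case (keep ws)
    then show False using oplus_neq_left[OF assms] by simp
  next
    case (absorb z ws)
    have "x \<oplus> (y \<oplus> z) = x" "mergeable x (y \<oplus> z)"
      using absorb assms oplus_assoc[of x y z] mergeable_assoc[of x y z] by auto
    then show False using oplus_neq_left by blast
  qed
qed

lemma coarsens_Cons_same: "coarsens (x # ys) (x # zs) \<longleftrightarrow> coarsens ys zs"
  by (auto elim!: coarsens_ConsE intro: coarsens.keep) (metis oplus_neq_left)+

text \<open>The block that yields \<open>x \<oplus> z\<close> starts with \<open>x\<close> and has at least one more entry \<open>w\<close>, and by
  associativity it can be bracketed so that \<open>x\<close> and \<open>w\<close> are merged first. This supplies the partner,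
  one entry shorter, of an element of the interval that keeps \<open>x\<close>.\<close>

lemma coarsens_Cons_absorbed:
  assumes "mergeable x z" "coarsens (x # ys) ((x \<oplus> z) # zs)"
  obtains w ws where "ys = w # ws" "mergeable x w" "coarsens ((x \<oplus> w) # ws) ((x \<oplus> z) # zs)"
proof -
  have *: "coarsens ys (z # zs)"
    using assms(2)
  proof (cases rule: coarsens_ConsE)
    case (keep us)
    then show ?thesis using oplus_neq_left[OF assms(1)] by simp
  next
    case (absorb u us)
    then show ?thesis using oplus_left_cancel[OF assms(1), of u] by auto
  qed
  then obtain w ws where ys: "ys = w # ws"
    by (auto elim: coarsens.cases)
  have "mergeable x w \<and> coarsens ((x \<oplus> w) # ws) ((x \<oplus> z) # zs)"
    using *[unfolded ys]
  proof (cases rule: coarsens_ConsE)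
    case (keep us)
    then show ?thesis using assms(1) by (auto intro: coarsens.keep)
  next
    case (absorb u us)
    have "mergeable x w" "mergeable (x \<oplus> w) u" "x \<oplus> z = x \<oplus> w \<oplus> u"
      using absorb assms(1) mergeable_assoc[of x w u] oplus_assoc[of x w u] by auto
    then show ?thesis using absorb by (auto intro: coarsens.absorb)
  qed
  then show thesis using that ys by blast
qed

section \<open>Cancellation of signs over an interval\<close>

lemma coarsens_interval_sign_sum:
  assumes "coarsens xs zs" "xs \<noteq> zs"
  shows "(\<Sum>ys | coarsens xs ys \<and> coarsens ys zs. (-1) ^ length ys) = (0 :: 'a :: ring_1)"
  using assms
proof (induction rule: coarsens.induct)
  case Nil
  then show ?case by simp
next
  case (keep xs zs x)
  have "{ys. coarsens (x # xs) ys \<and> coarsens ys (x # zs)} =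
      (#) x ` {ys. coarsens xs ys \<and> coarsens ys zs}"
    by (auto elim!: coarsens_ConsE[of x xs] simp: coarsens_Cons_same not_coarsens_oplus_Cons
        intro: coarsens.keep)
  then show ?case
    using keep by (simp add: sum.reindex sum_negf)
next
  case (absorb xs z zs x)
  \<comment> \<open>The tails \<open>w # ws\<close> that give the pair of \<open>x # w # ws\<close>, which keeps \<open>x\<close>, and \<open>(x \<oplus> w) # ws\<close>, which
    absorbs it; the interval is the disjoint union of both halves.\<close>
  let ?C = "{w # ws | w ws. coarsens xs (w # ws) \<and> mergeable x w \<and>
                coarsens ((x \<oplus> w) # ws) ((x \<oplus> z) # zs)}"
  let ?f = "\<lambda>ys. (x \<oplus> hd ys) # tl ys"
  have fin: "finite ?C"
    by (rule finite_subset[OF _ finite_coarsens[of xs]]) auto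
  have inj: "inj_on ?f ?C"
  proof (rule inj_onI)
    fix us vs assume "us \<in> ?C" "vs \<in> ?C" "?f us = ?f vs"
    then show "us = vs" using oplus_left_cancel[of x "hd us" "hd vs"] by auto
  qed
  have "{ys. coarsens (x # xs) ys \<and> coarsens ys ((x \<oplus> z) # zs)} = (#) x ` ?C \<union> ?f ` ?C"
    (is "?I = _")
  proof (intro equalityI subsetI)
    fix ys assume "ys \<in> ?I"
    then have ys: "coarsens (x # xs) ys" "coarsens ys ((x \<oplus> z) # zs)" by auto
    from ys(1) show "ys \<in> (#) x ` ?C \<union> ?f ` ?C"
    proof (cases rule: coarsens_ConsE)
      case (keep us)
      then obtain w ws where "us = w # ws" "mergeable x w" "coarsens ((x \<oplus> w) # ws) ((x \<oplus> z) # zs)"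
        using ys(2) coarsens_Cons_absorbed[OF \<open>mergeable x z\<close>] by metis
      then have "us \<in> ?C" using keep by blast
      then show ?thesis using keep by blast
    next
      case (absorb w ws)
      then have "w # ws \<in> ?C" using ys(2) absorb by blast
      then have "?f (w # ws) \<in> ?f ` ?C" by (rule imageI)
      then show ?thesis using absorb by simp
    qed
  next
    fix ys assume "ys \<in> (#) x ` ?C \<union> ?f ` ?C"
    then show "ys \<in> ?I"
      by (auto intro: coarsens.intros coarsens_split_head)
  qed
  moreover have "(#) x ` ?C \<inter> ?f ` ?C = {}"
    using oplus_neq_left[of x, THEN not_sym] by auto
  ultimately have "(\<Sum>ys\<in>?I. (-1) ^ length ys :: 'a) =
      (\<Sum>ys\<in>?C. (-1) ^ length (x # ys)) + (\<Sum>ys\<in>?C. (-1) ^ length (?f ys))"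
    using fin inj by (simp add: sum.union_disjoint sum.reindex del: length_Cons length_tl)
  also have "\<dots> = (\<Sum>ys\<in>?C. (-1) ^ length (x # ys) + (-1) ^ length (?f ys))"
    by (rule sum.distrib[symmetric])
  also have "\<dots> = 0"
    by (rule sum.neutral) auto
  finally show ?case .
qed

lemma interval_sign_sum:
  assumes "\<alpha> \<prec> \<beta>"
  shows "(\<Sum>\<gamma> | \<alpha> \<preceq> \<gamma> \<and> \<gamma> \<preceq> \<beta>. (-1) ^ \<ell> \<gamma>) = (0 :: 'a :: ring_1)"
proof -
  have "(\<Sum>\<gamma> | \<alpha> \<preceq> \<gamma> \<and> \<gamma> \<preceq> \<beta>. (-1) ^ \<ell> \<gamma> :: 'a) =
      (\<Sum>ys | coarsens (entries \<alpha>) ys \<and> coarsens ys (entries \<beta>). (-1) ^ length ys)"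
    by (rule sum.reindex_bij_witness[where i = DComp and j = entries])
      (auto simp: dcomp_le_iff_coarsens len_def)
  also have "\<dots> = 0"
    using assms
    by (intro coarsens_interval_sign_sum)
      (auto simp: dcomp_less_def dcomp_le_iff_coarsens dcomp.expand)
  finally show ?thesis .
qed

section \<open>Inversion\<close>

lemma dcomp_le_refl: "\<alpha> \<preceq> \<alpha>"
  by (simp add: dcomp_le_def)

lemma dcomp_le_trans: "\<alpha> \<preceq> \<beta> \<Longrightarrow> \<beta> \<preceq> \<gamma> \<Longrightarrow> \<alpha> \<preceq> \<gamma>"
  unfolding dcomp_le_def by (rule rtranclp_trans)

lemma dcomp_ge_eq_insert: "{\<beta>. \<alpha> \<preceq> \<beta>} = insert \<alpha> {\<beta>. \<alpha> \<prec> \<beta>}"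
  by (auto simp: dcomp_less_def dcomp_le_refl)

lemma interval_self: "{\<gamma>. \<alpha> \<preceq> \<gamma> \<and> \<gamma> \<preceq> \<alpha>} = {\<alpha>}"
proof -
  have "\<gamma> = \<alpha>" if "\<alpha> \<preceq> \<gamma>" "\<gamma> \<preceq> \<alpha>" for \<gamma>
    using that dcomp_less_len[of \<alpha> \<gamma>] dcomp_le_len[of \<gamma> \<alpha>] by (auto simp: dcomp_less_def)
  then show ?thesis by (auto simp: dcomp_le_refl)
qed

lemma sign_diff:
  "m \<le> n \<Longrightarrow> (-1) ^ (n - m) = (-1) ^ n * ((-1) ^ m :: 'a :: ring_1)"
  by (auto simp: uminus_power_if)

lemma interval_signed_sum:
  assumes "\<alpha> \<preceq> \<beta>"
  shows "(\<Sum>\<gamma> | \<alpha> \<preceq> \<gamma> \<and> \<gamma> \<preceq> \<beta>. (-1) ^ (\<ell> \<gamma> - \<ell> \<beta>)) = (if \<beta> = \<alpha> then 1 else 0 :: 'a :: ring_1)"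
proof (cases "\<beta> = \<alpha>")
  case True
  then show ?thesis by (simp add: interval_self)
next
  case False
  have "(\<Sum>\<gamma> | \<alpha> \<preceq> \<gamma> \<and> \<gamma> \<preceq> \<beta>. (-1) ^ (\<ell> \<gamma> - \<ell> \<beta>) :: 'a) =
      (\<Sum>\<gamma> | \<alpha> \<preceq> \<gamma> \<and> \<gamma> \<preceq> \<beta>. (-1) ^ \<ell> \<gamma>) * (-1) ^ \<ell> \<beta>"
    unfolding sum_distrib_right by (rule sum.cong) (auto simp: dcomp_le_len intro: sign_diff)
  then show ?thesis
    using False assms by (simp add: interval_sign_sum dcomp_less_def)
qed

text \<open>The alternating sums satisfy the relation that defines the ribbons: summed over all
  \<open>\<gamma> \<succeq> \<alpha>\<close>, they give back \<open>H \<alpha>\<close>, because exchanging the two summations leaves for each \<open>\<beta>\<close> a sign sum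
  over the interval from \<open>\<alpha>\<close> to \<open>\<beta>\<close>.\<close>

lemma sum_alternating_sums:
  fixes h :: "dcomp \<Rightarrow> 'a :: ring_1"
  shows "(\<Sum>\<gamma> | \<alpha> \<preceq> \<gamma>. \<Sum>\<beta> | \<gamma> \<preceq> \<beta>. (-1) ^ (\<ell> \<gamma> - \<ell> \<beta>) * h \<beta>) = h \<alpha>"
proof -
  let ?U = "{\<beta>. \<alpha> \<preceq> \<beta>}"
  let ?s = "\<lambda>\<gamma> \<beta>. (-1) ^ (\<ell> \<gamma> - \<ell> \<beta>) :: 'a"
  have "(\<Sum>\<gamma>\<in>?U. \<Sum>\<beta> | \<gamma> \<preceq> \<beta>. ?s \<gamma> \<beta> * h \<beta>) =
      (\<Sum>\<gamma>\<in>?U. \<Sum>\<beta> | \<beta> \<in> ?U \<and> \<gamma> \<preceq> \<beta>. ?s \<gamma> \<beta> * h \<beta>)"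
    by (intro sum.cong) (auto dest: dcomp_le_trans)
  also have "\<dots> = (\<Sum>\<beta>\<in>?U. \<Sum>\<gamma> | \<gamma> \<in> ?U \<and> \<gamma> \<preceq> \<beta>. ?s \<gamma> \<beta> * h \<beta>)"
    by (rule sum.swap_restrict) (simp_all add: finite_dcomp_ge)
  also have "\<dots> = (\<Sum>\<beta>\<in>?U. if \<beta> = \<alpha> then h \<beta> else 0)"
    by (rule sum.cong) (simp_all add: interval_signed_sum flip: sum_distrib_right)
  also have "\<dots> = h \<alpha>"
    by (simp add: finite_dcomp_ge dcomp_le_refl)
  finally show ?thesis .
qed

theorem proposition6p5:
  fixes \<alpha> :: dcomp
  shows "R \<alpha> = (\<Sum>\<beta> | \<alpha> \<preceq> \<beta>. (-1) ^ (\<ell> \<alpha> - \<ell> \<beta>) * H \<beta>)"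
proof (induction "\<ell> \<alpha>" arbitrary: \<alpha> rule: less_induct)
  case less
  let ?Q = "\<lambda>\<gamma>. \<Sum>\<beta> | \<gamma> \<preceq> \<beta>. (-1) ^ (\<ell> \<gamma> - \<ell> \<beta>) * H \<beta>"
  have "R \<alpha> = H \<alpha> - (\<Sum>\<gamma> | \<alpha> \<prec> \<gamma>. ?Q \<gamma>)"
    unfolding R.simps[of \<alpha>] by (simp add: less dcomp_less_len)
  moreover have "H \<alpha> = (\<Sum>\<gamma>\<in>insert \<alpha> {\<gamma>. \<alpha> \<prec> \<gamma>}. ?Q \<gamma>)"
    using sum_alternating_sums[of H \<alpha>] by (simp only: dcomp_ge_eq_insert[of \<alpha>])
  moreover have "\<dots> = ?Q \<alpha> + (\<Sum>\<gamma> | \<alpha> \<prec> \<gamma>. ?Q \<gamma>)"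
    by (rule sum.insert) (rule finite_dcomp_greater, simp add: dcomp_less_def)
  ultimately show ?case by simp
qed

end
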